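(* Let $F(d)=2(\sqrt{d-1}-1)/d$ for real $d\ge1$. Then $F(d)\to0^+$ as $d\to\infty$; over real $d$ the function $F$ attains its maximum at $d=4+2\sqrt2$; and over the integers its maximum is $F(7)=\tfrac{2(\sqrt6-1)}{7}$. Consequently, for $g\ge6$, letting $S_{g,d}$ be the cycle $C_g$ with $d-2$ pendant leaves at each cycle vertex, $\{S_{g,d}\}_{d\ge3}$ is a family of unicyclic graphs carrying discrete Einstein metrics whose curvatures $\kappa=-\lambda_{\max}(R_{S_{g,d}})$ are negative and tend to $0$ as $d\to\infty$, and $$\lambda_{\max}(R_{S_{g,d}})\le\frac{2(\sqrt6-1)}{7}\qquad\text{for all }d\ge3,$$ independently of $g$.
   Context: Weighted graphs: $G=(V,E)$ is a finite connected simple graph, $w:E\to\mathbb{R}_{>0}$ an edge weighting, $d_v$ the combinatorial degree, and $d(x,y)$ the least total weight of a path from $x$ to $y$. Lin--Lu--Yau curvature: for $\alpha\in[0,1]$ let $\mu_x^\alpha$ be the probability measure with mass $\alpha$ at $x$ and $(1-\alpha)/d_x$ at each neighbour of $x$. Let $W$ be the $L^1$-Wasserstein distance with respect to $d$. For an edge $x\sim y$ put $\kappa_\alpha(x,y)=1-W(\mu_x^\alpha,\mu_y^\alpha)/d(x,y)$ and $\kappa_{xy}=\lim_{\alpha\to1}\kappa_\alpha(x,y)/(1-\alpha)$. A positive weighting $w$ is a discrete Einstein metric of curvature $\kappa$ if $\kappa_e=\kappa$ for every edge $e$. Ricci matrix: $R_G\in\mathbb{R}^{E\times E}$ has diagonal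 entries $-(1/d_x+1/d_y)$ for $e=\{x,y\}$, entry $1/d_z$ for $e\ne e'$ with $e\cap e'=\{z\}$, and $0$ for disjoint edges; $\lambda_{\max}$ denotes its largest eigenvalue. *)

theory Defs
  imports "HOL-Probability.Probability"
begin

section \<open>Finite connected simple graphs\<close>

text \<open>
  A graph is given by its vertex set \<open>V\<close> and its set \<open>E\<close> of edges, an edge being a
  two-element subset of \<open>V\<close>. In particular \<open>{x, x} \<notin> E\<close>.
\<close>

definition simple_graph :: "'a set \<Rightarrow> 'a set set \<Rightarrow> bool" where
  "simple_graph V E \<longleftrightarrow> finite V \<and> (\<forall>e\<in>E. e \<subseteq> V \<and> card e = 2)"

definition neighbours :: "'a set set \<Rightarrow> 'a \<Rightarrow> 'a set" where
  "neighbours E x = {y. {x, y} \<in> E}"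

definition vdegree :: "'a set set \<Rightarrow> 'a \<Rightarrow> nat" where
  "vdegree E x = card (neighbours E x)"

definition graph_path :: "'a set \<Rightarrow> 'a set set \<Rightarrow> 'a \<Rightarrow> 'a list \<Rightarrow> 'a \<Rightarrow> bool" where
  "graph_path V E x p y \<longleftrightarrow>
     p \<noteq> [] \<and> hd p = x \<and> last p = y \<and> set p \<subseteq> V \<and> distinct p \<and>
     successively (\<lambda>u v. {u, v} \<in> E) p"

definition connected_graph :: "'a set \<Rightarrow> 'a set set \<Rightarrow> bool" where
  "connected_graph V E \<longleftrightarrow>
     simple_graph V E \<and> V \<noteq> {} \<and> (\<forall>x\<in>V. \<forall>y\<in>V. \<exists>p. graph_path V E x p y)"

text \<open>
  Cycles are identified with their edge sets, so that rotating or reversing the list of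
  vertices does not produce a new cycle.
\<close>

definition graph_cycle :: "'a set \<Rightarrow> 'a set set \<Rightarrow> 'a set set \<Rightarrow> bool" where
  "graph_cycle V E C \<longleftrightarrow>
     C \<subseteq> E \<and>
     (\<exists>p. length p \<ge> 3 \<and> distinct p \<and> set p \<subseteq> V \<and>
          C = {{p ! i, p ! (Suc i mod length p)} |i. i < length p})"

definition unicyclic :: "'a set \<Rightarrow> 'a set set \<Rightarrow> bool" where
  "unicyclic V E \<longleftrightarrow> connected_graph V E \<and> (\<exists>!C. graph_cycle V E C)"


section \<open>Weighted distance and Lin--Lu--Yau curvature\<close>

definition path_weight :: "('a set \<Rightarrow> real) \<Rightarrow> 'a list \<Rightarrow> real" where
  "path_weight w p = (\<Sum>(u, v)\<leftarrow>zip p (tl p). w {u, v})"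

definition graph_dist ::
  "'a set \<Rightarrow> 'a set set \<Rightarrow> ('a set \<Rightarrow> real) \<Rightarrow> 'a \<Rightarrow> 'a \<Rightarrow> real" where
  "graph_dist V E w x y = Min {path_weight w p |p. graph_path V E x p y}"

text \<open>
  For \<open>\<alpha> \<in> [0, 1]\<close> and a vertex \<open>x\<close> with finitely many and at least one neighbour: mass
  \<open>\<alpha>\<close> at \<open>x\<close> and \<open>(1 - \<alpha>) / d\<^sub>x\<close> at each neighbour of \<open>x\<close>
  (see \<open>pmf_lazy_step\<close> below).
\<close>

definition lazy_step :: "'a set set \<Rightarrow> real \<Rightarrow> 'a \<Rightarrow> 'a pmf" where
  "lazy_step E \<alpha> x =
     bind_pmf (bernoulli_pmf \<alpha>)
       (\<lambda>stay. if stay then return_pmf x else pmf_of_set (neighbours E x))"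

lemma pmf_lazy_step:
  assumes "0 \<le> \<alpha>" "\<alpha> \<le> 1" "finite (neighbours E x)" "neighbours E x \<noteq> {}" "x \<notin> neighbours E x"
  shows "pmf (lazy_step E \<alpha> x) y =
           (if y = x then \<alpha> else if y \<in> neighbours E x then (1 - \<alpha>) / vdegree E x else 0)"
  using assms by (auto simp: lazy_step_def pmf_bind vdegree_def indicator_def)

definition wasserstein :: "('a \<Rightarrow> 'a \<Rightarrow> real) \<Rightarrow> 'a pmf \<Rightarrow> 'a pmf \<Rightarrow> real" where
  "wasserstein d \<mu> \<nu> =
     Inf {measure_pmf.expectation \<pi> (\<lambda>(u, v). d u v) |\<pi>.
            map_pmf fst \<pi> = \<mu> \<and> map_pmf snd \<pi> = \<nu>}"

definition alpha_curvature ::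
  "'a set \<Rightarrow> 'a set set \<Rightarrow> ('a set \<Rightarrow> real) \<Rightarrow> real \<Rightarrow> 'a \<Rightarrow> 'a \<Rightarrow> real" where
  "alpha_curvature V E w \<alpha> x y =
     1 - wasserstein (graph_dist V E w) (lazy_step E \<alpha> x) (lazy_step E \<alpha> y)
           / graph_dist V E w x y"

text \<open>The limit is from the left because only \<open>\<alpha> \<in> [0, 1]\<close> is meaningful.\<close>

definition has_LLY_curvature ::
  "'a set \<Rightarrow> 'a set set \<Rightarrow> ('a set \<Rightarrow> real) \<Rightarrow> 'a \<Rightarrow> 'a \<Rightarrow> real \<Rightarrow> bool" where
  "has_LLY_curvature V E w x y \<kappa> \<longleftrightarrow>
     ((\<lambda>\<alpha>. alpha_curvature V E w \<alpha> x y / (1 - \<alpha>)) \<longlongrightarrow> \<kappa>) (at_left 1)"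

definition discrete_Einstein_metric ::
  "'a set \<Rightarrow> 'a set set \<Rightarrow> ('a set \<Rightarrow> real) \<Rightarrow> real \<Rightarrow> bool" where
  "discrete_Einstein_metric V E w \<kappa> \<longleftrightarrow>
     (\<forall>e\<in>E. w e > 0) \<and> (\<forall>x y. {x, y} \<in> E \<longrightarrow> has_LLY_curvature V E w x y \<kappa>)"


section \<open>The Ricci matrix\<close>

text \<open>
  Matrices indexed by a finite set \<open>I\<close> are functions of two arguments, of which only the
  values on \<open>I \<times> I\<close> matter. The off-diagonal sum below has at most one term, since two
  distinct edges of a simple graph share at most one vertex.
\<close>

definition ricci_matrix :: "'a set set \<Rightarrow> 'a set \<Rightarrow> 'a set \<Rightarrow> real" where
  "ricci_matrix E e e' =
     (if e = e' then - (\<Sum>x\<in>e. 1 / vdegree E x) else (\<Sum>z\<in>e \<inter> e'. 1 / vdegree E z))"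

definition eigenvalue_on :: "'i set \<Rightarrow> ('i \<Rightarrow> 'i \<Rightarrow> real) \<Rightarrow> real \<Rightarrow> bool" where
  "eigenvalue_on I A k \<longleftrightarrow>
     (\<exists>v. (\<exists>i\<in>I. v i \<noteq> 0) \<and> (\<forall>i\<in>I. (\<Sum>j\<in>I. A i j * v j) = k * v i))"

definition lambda_max :: "'i set \<Rightarrow> ('i \<Rightarrow> 'i \<Rightarrow> real) \<Rightarrow> real" where
  "lambda_max I A = Max {k. eigenvalue_on I A k}"


section \<open>The graphs \<open>S\<^bsub>g,d\<^esub>\<close> and the function \<open>F\<close>\<close>

text \<open>
  The vertices \<open>(i, 0)\<close> with \<open>i < g\<close> form the cycle (for \<open>g \<ge> 3\<close>), and the vertices
  \<open>(i, j)\<close> with \<open>1 \<le> j \<le> d - 2\<close> are the leaves attached to \<open>(i, 0)\<close> (for \<open>d \<ge> 2\<close>).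
\<close>

definition S_verts :: "nat \<Rightarrow> nat \<Rightarrow> (nat \<times> nat) set" where
  "S_verts g d = {..<g} \<times> {0..d - 2}"

definition S_edges :: "nat \<Rightarrow> nat \<Rightarrow> (nat \<times> nat) set set" where
  "S_edges g d =
     {{(i, 0), (Suc i mod g, 0)} |i. i < g} \<union>
     {{(i, 0), (i, j)} |i j. i < g \<and> j \<in> {1..d - 2}}"

abbreviation S_lambda_max :: "nat \<Rightarrow> nat \<Rightarrow> real" where
  "S_lambda_max g d \<equiv> lambda_max (S_edges g d) (ricci_matrix (S_edges g d))"

definition F_fun :: "real \<Rightarrow> real" where
  "F_fun d = 2 * (sqrt (d - 1) - 1) / d"

end

theory Submission
  imports Defs "HOL-Real_Asymp.Real_Asymp"
begin

text \<open>
  On \<open>S\<^bsub>g,d\<^esub>\<close> give the cycle edges weight \<open>sqrt (d - 1) + 1\<close> and the leaf edges weight \<open>1\<close>. This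
  is a positive eigenvector of the Ricci matrix with eigenvalue \<open>F(d)\<close>; off-diagonal entries
  being nonnegative, Perron--Frobenius gives \<open>\<lambda>\<^sub>m\<^sub>a\<^sub>x = F(d)\<close>. If an edge \<open>x y\<close> admits a
  1-Lipschitz potential that is tight on all paths \<open>u, x, y, v\<close>, Kantorovich duality against the
  maximal coupling computes \<open>W(\<mu>\<^sub>x, \<mu>\<^sub>y)\<close> exactly for \<open>\<alpha> > 1/2\<close>, and the curvature of the edge
  is \<open>- (R w)\<^sub>e / w\<^sub>e\<close>. Such potentials exist on \<open>S\<^bsub>g,d\<^esub>\<close> for \<open>g \<ge> 6\<close>, so the weights have constant
  curvature \<open>- F(d)\<close>.
\<close>


section \<open>Transport on weighted graphs\<close>

lemma path_weight_Cons2: "path_weight w (u # v # p) = w {u, v} + path_weight w (v # p)"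
  by (simp add: path_weight_def)

lemma path_weight_single [simp]: "path_weight w [u] = 0"
  by (simp add: path_weight_def)

text \<open>The differences of \<open>f\<close> telescope along the path.\<close>

lemma lipschitz_le_path_weight:
  assumes "\<And>u v. {u, v} \<in> E \<Longrightarrow> f u - f v \<le> w {u, v}"
    and "graph_path V E x p y"
  shows "f x - f y \<le> path_weight w p"
proof -
  have "p \<noteq> [] \<Longrightarrow> successively (\<lambda>u v. {u, v} \<in> E) p \<Longrightarrow> f (hd p) - f (last p) \<le> path_weight w p"
  proof (induction p rule: induct_list012)
    case (3 u v p)
    then have "f v - f (last (v # p)) \<le> path_weight w (v # p)" and "f u - f v \<le> w {u, v}"
      using assms(1) by auto
    then show ?case by (simp add: path_weight_Cons2)
  qed auto
  then show ?thesis using assms(2) by (auto simp: graph_path_def)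
qed

text \<open>Paths do not repeat vertices, so their length is at most \<open>card V\<close>. This
  makes the \<open>Min\<close> in \<open>graph_dist\<close> range over a finite set.\<close>

lemma finite_graph_paths:
  assumes "finite V"
  shows "finite {p. graph_path V E x p y}"
proof (rule finite_subset)
  show "{p. graph_path V E x p y} \<subseteq> {p. set p \<subseteq> V \<and> length p \<le> card V}"
    using assms by (auto simp: graph_path_def) (metis card_mono distinct_card)
  show "finite {p. set p \<subseteq> V \<and> length p \<le> card V}"
    using assms by (rule finite_lists_length_le)
qed

lemma graph_dist_le:
  assumes "finite V" "graph_path V E x p y"
  shows "graph_dist V E w x y \<le> path_weight w p"
  unfolding graph_dist_def using assms finite_graph_paths[OF assms(1)]
  by (intro Min_le) (auto simp: Setcompr_eq_image)

text \<open>Connectedness supplies at least one path, so \<open>Min\<close> is a genuine minimum and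
  the bound on every single path passes to it.\<close>

lemma le_graph_dist:
  assumes "connected_graph V E" "x \<in> V" "y \<in> V"
    and "\<And>u v. {u, v} \<in> E \<Longrightarrow> f u - f v \<le> w {u, v}"
  shows "f x - f y \<le> graph_dist V E w x y"
proof -
  have fin: "finite V" and ne: "\<exists>p. graph_path V E x p y"
    using assms by (auto simp: connected_graph_def simple_graph_def)
  show ?thesis unfolding graph_dist_def
    using finite_graph_paths[OF fin, of E x y] ne lipschitz_le_path_weight[of E f w V x _ y] assms(4)
    by (subst Min_ge_iff) (auto simp: Setcompr_eq_image)
qed

section \<open>Maximal couplings and Kantorovich duality\<close>

text \<open>The maximal coupling: the common mass \<open>min (pmf p u) (pmf q u)\<close> stays on
  the diagonal, and the surplus \<open>P\<close> of \<open>p\<close> over \<open>q\<close> is sent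
  to the surplus \<open>Q\<close> of \<open>q\<close> over \<open>p\<close> by a normalised product.
  Mass therefore moves only from points where \<open>p\<close> is larger to points where
  \<open>q\<close> is larger.\<close>

lemma exists_coupling_off_diagonal:
  fixes p q :: "'a pmf"
  assumes "finite (set_pmf p)" "finite (set_pmf q)"
  obtains \<pi> where "map_pmf fst \<pi> = p" "map_pmf snd \<pi> = q"
    "\<And>u v. (u, v) \<in> set_pmf \<pi> \<Longrightarrow> u = v \<or> pmf q u < pmf p u \<and> pmf p v < pmf q v"
proof -
  define A where "A = set_pmf p \<union> set_pmf q"
  have A: "finite A" using assms by (auto simp: A_def)
  have sum1: "(\<Sum>u\<in>A. pmf p u) = 1" "(\<Sum>u\<in>A. pmf q u) = 1"
    using A by (auto simp: A_def intro!: sum_pmf_eq_1)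
  have out: "pmf p u = 0" "pmf q u = 0" if "u \<notin> A" for u
    using that by (auto simp: A_def set_pmf_iff)
  define P where "P u = max (pmf p u - pmf q u) 0" for u
  define Q where "Q u = max (pmf q u - pmf p u) 0" for u
  define T where "T = sum P A"
  have "sum P A - sum Q A = (\<Sum>u\<in>A. pmf p u - pmf q u)"
    unfolding sum_subtractf[symmetric] by (intro sum.cong) (auto simp: P_def Q_def)
  then have T: "sum Q A = T" using sum1 by (simp add: T_def sum_subtractf)
  have nn: "P u \<ge> 0" "Q u \<ge> 0" for u by (auto simp: P_def Q_def)
  \<comment> \<open>If \<open>T = 0\<close> then \<open>p\<close> and \<open>q\<close> agree, both
    surpluses vanish on \<open>A\<close>, and division by zero gives the required 0. No case split
    on \<open>T\<close> is then needed for \<open>h\<close>.\<close>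
  have PT: "P u * T / T = P u" "Q u * T / T = Q u" if "u \<in> A" for u
  proof -
    have "P u = 0 \<and> Q u = 0" if "T = 0"
      using that T A nn \<open>u \<in> A\<close> by (metis T_def sum_nonneg_eq_0_iff)
    then show "P u * T / T = P u" "Q u * T / T = Q u" by auto
  qed
  define h where "h = (\<lambda>(u, v). (if u = v then min (pmf p u) (pmf q u) else 0) + P u * Q v / T)"
  have h0: "h z \<ge> 0" for z
    using nn by (auto simp: h_def T_def split: prod.split intro!: add_nonneg_nonneg divide_nonneg_nonneg sum_nonneg)
  have hout: "h z = 0" if "z \<notin> A \<times> A" for z
  proof -
    have "P u = 0" "Q u = 0" "min (pmf p u) (pmf q u) = 0" if "u \<notin> A" for u
      using out[OF that] by (auto simp: P_def Q_def)
    then show ?thesis using that by (cases z) (auto simp: h_def)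
  qed
  have row: "(\<Sum>v\<in>A. h (u, v)) = pmf p u" if "u \<in> A" for u
  proof -
    have "(\<Sum>v\<in>A. h (u, v)) = min (pmf p u) (pmf q u) + P u * T / T"
      using that A by (simp add: h_def sum.distrib sum_distrib_left[symmetric] sum_divide_distrib[symmetric] T)
    then show ?thesis using PT[OF that] by (auto simp: P_def)
  qed
  have col: "(\<Sum>u\<in>A. h (u, v)) = pmf q v" if "v \<in> A" for v
  proof -
    have "(\<Sum>u\<in>A. h (u, v)) = min (pmf p v) (pmf q v) + Q v * T / T"
      using that A by (simp add: h_def sum.distrib sum_distrib_right[symmetric] sum_divide_distrib[symmetric] T_def mult.commute)
    then show ?thesis using PT[OF that] by (auto simp: Q_def)
  qed
  have "(\<Sum>z\<in>A\<times>A. h z) = 1"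
    unfolding sum.cartesian_product' using row sum1 by simp
  then have "(\<integral>\<^sup>+ z. ennreal (h z) \<partial>count_space UNIV) = 1"
    using A h0 hout by (subst nn_integral_count_space'[of "A \<times> A"]) (auto simp: sum_ennreal)
  then have pmf\<pi>: "pmf (embed_pmf h) z = h z" for z
    using h0 by (intro pmf_embed_pmf) auto
  define \<pi> where "\<pi> = embed_pmf h"
  have sup: "set_pmf \<pi> \<subseteq> A \<times> A"
    using hout by (auto simp: \<pi>_def set_pmf_iff pmf\<pi>) (metis mem_Sigma_iff)+
  have "pmf (map_pmf fst \<pi>) u = pmf p u" for u
  proof (cases "u \<in> A")
    case True
    have "pmf (map_pmf fst \<pi>) u = measure (measure_pmf \<pi>) ({u} \<times> A)"
      unfolding pmf_map using sup by (intro measure_pmf.finite_measure_eq_AE) (auto simp: AE_measure_pmf_iff)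
    also have "\<dots> = (\<Sum>z\<in>{u} \<times> A. h z)" using A by (simp add: measure_measure_pmf_finite \<pi>_def pmf\<pi>)
    also have "\<dots> = (\<Sum>v\<in>A. h (u, v))" using A by (simp add: sum.cartesian_product')
    finally show ?thesis using row True by simp
  next
    case False
    then have "pmf (map_pmf fst \<pi>) u = 0" using sup by (auto simp: pmf_eq_0_set_pmf)
    then show ?thesis using out False by simp
  qed
  moreover have "pmf (map_pmf snd \<pi>) v = pmf q v" for v
  proof (cases "v \<in> A")
    case True
    have "pmf (map_pmf snd \<pi>) v = measure (measure_pmf \<pi>) (A \<times> {v})"
      unfolding pmf_map using sup by (intro measure_pmf.finite_measure_eq_AE) (auto simp: AE_measure_pmf_iff)
    also have "\<dots> = (\<Sum>z\<in>A \<times> {v}. h z)" using A by (simp add: measure_measure_pmf_finite \<pi>_def pmf\<pi>)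
    also have "\<dots> = (\<Sum>u\<in>A. h (u, v))" using A by (simp add: sum.cartesian_product')
    finally show ?thesis using col True by simp
  next
    case False
    then have "pmf (map_pmf snd \<pi>) v = 0" using sup by (auto simp: pmf_eq_0_set_pmf)
    then show ?thesis using out False by simp
  qed
  moreover have "u = v \<or> pmf q u < pmf p u \<and> pmf p v < pmf q v" if "(u, v) \<in> set_pmf \<pi>" for u v
  proof -
    have "h (u, v) \<noteq> 0" using that by (simp add: \<pi>_def set_pmf_iff pmf\<pi>)
    then show ?thesis by (auto simp: h_def P_def Q_def max_def split: if_splits)
  qed
  ultimately show ?thesis using that[of \<pi>] by (auto intro!: pmf_eqI)
qed

text \<open>
  The easy half of Kantorovich duality: a feasible potential whose constraint is tight on the
  support of some coupling certifies that this coupling is optimal.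
\<close>

lemma wasserstein_eqI:
  fixes \<mu> \<nu> :: "'a pmf"
  assumes fin: "finite (set_pmf \<mu>)" "finite (set_pmf \<nu>)"
    and lip: "\<And>u v. u \<in> set_pmf \<mu> \<Longrightarrow> v \<in> set_pmf \<nu> \<Longrightarrow> f u - f v \<le> d u v"
    and \<pi>: "map_pmf fst \<pi> = \<mu>" "map_pmf snd \<pi> = \<nu>"
    and tight: "\<And>u v. (u, v) \<in> set_pmf \<pi> \<Longrightarrow> d u v \<le> f u - f v"
  shows "wasserstein d \<mu> \<nu> = measure_pmf.expectation \<mu> f - measure_pmf.expectation \<nu> f"
proof -
  \<comment> \<open>The mean of \<open>f u - f v\<close> depends only on the marginals, so it is the
    same for every coupling.\<close>
  have *: "finite (set_pmf \<rho>) \<and> set_pmf \<rho> \<subseteq> set_pmf \<mu> \<times> set_pmf \<nu> \<and>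
      measure_pmf.expectation \<rho> (\<lambda>(u, v). f u - f v) =
      measure_pmf.expectation \<mu> f - measure_pmf.expectation \<nu> f"
    if \<rho>: "map_pmf fst \<rho> = \<mu>" "map_pmf snd \<rho> = \<nu>" for \<rho>
  proof -
    have sub: "set_pmf \<rho> \<subseteq> set_pmf \<mu> \<times> set_pmf \<nu>"
      unfolding \<rho>[symmetric] by force
    then have fin\<rho>: "finite (set_pmf \<rho>)" using fin by (meson finite_SigmaI finite_subset)
    have "measure_pmf.expectation \<rho> (\<lambda>(u, v). f u - f v) =
      measure_pmf.expectation \<rho> (\<lambda>z. f (fst z)) - measure_pmf.expectation \<rho> (\<lambda>z. f (snd z))"
      unfolding case_prod_beta using fin\<rho>
      by (intro Bochner_Integration.integral_diff integrable_measure_pmf_finite)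
    then show ?thesis using sub fin\<rho> by (simp add: \<rho>[symmetric])
  qed
  have ge: "measure_pmf.expectation \<mu> f - measure_pmf.expectation \<nu> f
      \<le> measure_pmf.expectation \<rho> (\<lambda>(u, v). d u v)"
    if \<rho>: "map_pmf fst \<rho> = \<mu>" "map_pmf snd \<rho> = \<nu>" for \<rho>
  proof -
    have "measure_pmf.expectation \<rho> (\<lambda>(u, v). f u - f v) \<le> measure_pmf.expectation \<rho> (\<lambda>(u, v). d u v)"
      using *[OF \<rho>] lip
      by (intro integral_mono_AE integrable_measure_pmf_finite) (auto simp: AE_measure_pmf_iff)
    then show ?thesis using *[OF \<rho>] by simp
  qed
  have le: "measure_pmf.expectation \<pi> (\<lambda>(u, v). d u v)
      \<le> measure_pmf.expectation \<mu> f - measure_pmf.expectation \<nu> f"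
  proof -
    have "measure_pmf.expectation \<pi> (\<lambda>(u, v). d u v) \<le> measure_pmf.expectation \<pi> (\<lambda>(u, v). f u - f v)"
      using *[OF \<pi>] tight
      by (intro integral_mono_AE integrable_measure_pmf_finite) (auto simp: AE_measure_pmf_iff)
    then show ?thesis using *[OF \<pi>] by simp
  qed
  have "measure_pmf.expectation \<mu> f - measure_pmf.expectation \<nu> f
      = measure_pmf.expectation \<pi> (\<lambda>(u, v). d u v)"
    using le ge[OF \<pi>] by linarith
  then show ?thesis unfolding wasserstein_def
    using \<pi> ge by (intro cInf_eq_minimum) auto
qed


section \<open>Curvature from edge potentials\<close>

lemma ricci_matrix_commute: "ricci_matrix E e e' = ricci_matrix E e' e"
  by (auto simp: ricci_matrix_def Int_commute)

lemma neighbours_subset: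
  assumes "simple_graph V E"
  shows "neighbours E x \<subseteq> V - {x}" and "finite (neighbours E x)"
proof -
  show "neighbours E x \<subseteq> V - {x}" using assms by (auto simp: simple_graph_def neighbours_def)
  then show "finite (neighbours E x)" using assms by (meson finite_Diff finite_subset simple_graph_def)
qed

lemma finite_edges:
  assumes "simple_graph V E"
  shows "finite E"
  using assms by (intro finite_subset[of E "Pow V"]) (auto simp: simple_graph_def)

lemma expectation_lazy_step:
  fixes f :: "'a \<Rightarrow> real"
  assumes "0 \<le> \<alpha>" "\<alpha> \<le> 1" "finite (neighbours E x)" "neighbours E x \<noteq> {}"
  shows "measure_pmf.expectation (lazy_step E \<alpha> x) f =
    \<alpha> * f x + (1 - \<alpha>) * (\<Sum>u\<in>neighbours E x. f u) / vdegree E x"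
proof -
  have "measure_pmf.expectation (lazy_step E \<alpha> x) f =
    measure_pmf.expectation (bernoulli_pmf \<alpha>) (\<lambda>b. measure_pmf.expectation
      (if b then return_pmf x else pmf_of_set (neighbours E x)) f)"
    unfolding lazy_step_def using assms
    by (intro pmf_expectation_bind[of UNIV, THEN trans] refl)
      (auto simp: integral_measure_pmf[of UNIV] set_pmf_bernoulli)
  also have "\<dots> = \<alpha> * f x + (1 - \<alpha>) * ((\<Sum>u\<in>neighbours E x. f u) / vdegree E x)"
    using assms by (simp add: integral_pmf_of_set vdegree_def)
  finally show ?thesis by simp
qed

text \<open>
  A potential certifying an optimal transport between the lazy steps from \<open>x\<close> and \<open>y\<close>:
  1-Lipschitz, and decreasing at full rate along every path of the form \<open>u, x, y, v\<close>.
\<close>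

definition edge_potential :: "'a set set \<Rightarrow> ('a set \<Rightarrow> real) \<Rightarrow> 'a \<Rightarrow> 'a \<Rightarrow> ('a \<Rightarrow> real) \<Rightarrow> bool" where
  "edge_potential E w x y f \<longleftrightarrow>
     (\<forall>u v. {u, v} \<in> E \<longrightarrow> f u - f v \<le> w {u, v}) \<and> f x - f y = w {x, y} \<and>
     (\<forall>u\<in>neighbours E x - {y}. f u - f x = w {x, u}) \<and>
     (\<forall>v\<in>neighbours E y - {x}. f y - f v = w {y, v})"

text \<open>Negation reverses the direction of descent, so a potential for one orientation of an
  edge suffices.\<close>

lemma edge_potential_uminus:
  assumes "edge_potential E w x y f"
  shows "edge_potential E w y x (\<lambda>z. - f z)"
proof -
  have "- f u - - f v \<le> w {u, v}" if "{u, v} \<in> E" for u v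
  proof -
    have "{v, u} \<in> E" using that by (simp add: insert_commute)
    then have "f v - f u \<le> w {v, u}" using assms by (simp add: edge_potential_def)
    then show ?thesis by (simp add: insert_commute)
  qed
  then show ?thesis using assms unfolding edge_potential_def by (auto simp: insert_commute)
qed

text \<open>Each sum over neighbours counts the edge \<open>{x, y}\<close> itself with coefficient
  plus one over the degree, whereas the diagonal entry has minus that; this accounts for the
  correction by \<open>2 * w {x, y}\<close> at each end.\<close>

lemma sum_ricci_matrix:
  assumes G: "simple_graph V E" and e: "{x, y} \<in> E"
  shows "(\<Sum>e'\<in>E. ricci_matrix E {x, y} e' * w e') =
    ((\<Sum>u\<in>neighbours E x. w {x, u}) - 2 * w {x, y}) / vdegree E x +
    ((\<Sum>v\<in>neighbours E y. w {y, v}) - 2 * w {x, y}) / vdegree E y"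
proof -
  note E = finite_edges[OF G]
  have xy: "x \<noteq> y" using G e by (auto simp: simple_graph_def)
  \<comment> \<open>The edges at \<open>z\<close> correspond bijectively to the neighbours of
    \<open>z\<close>.\<close>
  have incident: "(\<Sum>e'\<in>E. if z \<in> e' then w e' else 0) = (\<Sum>u\<in>neighbours E z. w {z, u})" for z
  proof -
    have "(\<lambda>u. {z, u}) ` neighbours E z = {e'\<in>E. z \<in> e'}"
    proof (intro equalityI subsetI)
      fix e' assume "e' \<in> {e'\<in>E. z \<in> e'}"
      moreover from this obtain a b where "e' = {a, b}"
        using G by (auto simp: simple_graph_def card_2_iff)
      ultimately show "e' \<in> (\<lambda>u. {z, u}) ` neighbours E z"
        by (auto simp: neighbours_def insert_commute image_iff)
    qed (auto simp: neighbours_def)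
    moreover have "inj_on (\<lambda>u. {z, u}) (neighbours E z)" by (auto simp: inj_on_def doubleton_eq_iff)
    ultimately have "(\<Sum>e'\<in>{e'\<in>E. z \<in> e'}. w e') = (\<Sum>u\<in>neighbours E z. w {z, u})"
      using sum.reindex[of "\<lambda>u. {z, u}" "neighbours E z" w] by (simp add: o_def)
    then show ?thesis using E by (simp add: sum.inter_filter)
  qed
  have entry: "ricci_matrix E {x, y} e' * w e' =
      (if x \<in> e' then w e' else 0) / vdegree E x + (if y \<in> e' then w e' else 0) / vdegree E y -
      (if e' = {x, y} then 2 * w e' / vdegree E x + 2 * w e' / vdegree E y else 0)"
    if "e' \<in> E" for e'
  proof (cases "e' = {x, y}")
    case True
    then show ?thesis using xy by (simp add: ricci_matrix_def field_simps)
  next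
    case False
    then show ?thesis using xy
      by (cases "x \<in> e'"; cases "y \<in> e'") (simp_all add: ricci_matrix_def distrib_right)
  qed
  have "(\<Sum>e'\<in>E. ricci_matrix E {x, y} e' * w e') =
    (\<Sum>e'\<in>E. if x \<in> e' then w e' else 0) / vdegree E x +
    (\<Sum>e'\<in>E. if y \<in> e' then w e' else 0) / vdegree E y -
    (2 * w {x, y} / vdegree E x + 2 * w {x, y} / vdegree E y)"
    using E e by (simp add: entry sum.distrib sum_subtractf sum_divide_distrib[symmetric] cong: sum.cong)
  then show ?thesis unfolding incident by (simp add: diff_divide_distrib)
qed

section \<open>Exact transport cost between the lazy steps at an edge\<close>

text \<open>The edge itself is a path, and the Lipschitz function \<open>f\<close> rules out a
  cheaper one.\<close>

lemma graph_dist_edge: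
  assumes G: "connected_graph V E" and e: "{x, y} \<in> E"
    and lip: "\<And>u v. {u, v} \<in> E \<Longrightarrow> f u - f v \<le> w {u, v}" and f: "f x - f y = w {x, y}"
  shows "graph_dist V E w x y = w {x, y}"
proof -
  have xy: "x \<in> V" "y \<in> V" "x \<noteq> y" "finite V"
    using G e by (auto simp: connected_graph_def simple_graph_def)
  have "graph_path V E x [x, y] y" using xy e by (simp add: graph_path_def)
  from graph_dist_le[OF xy(4) this, of w] have "graph_dist V E w x y \<le> w {x, y}"
    by (simp add: path_weight_Cons2)
  moreover have "f x - f y \<le> graph_dist V E w x y" using G xy lip by (intro le_graph_dist)
  ultimately show ?thesis using f by simp
qed

text \<open>The path \<open>u, x, y, v\<close>, shortened when \<open>u = x\<close> or
  \<open>v = y\<close>, has total weight \<open>f u - f v\<close>.\<close>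

lemma graph_dist_le_edge_potential:
  assumes V: "simple_graph V E" and e: "{x, y} \<in> E" and pos: "\<And>e. e \<in> E \<Longrightarrow> w e > 0"
    and f: "edge_potential E w x y f"
    and u: "u \<in> insert x (neighbours E x - {y})" and v: "v \<in> insert y (neighbours E y - {x})"
  shows "graph_dist V E w u v \<le> f u - f v"
proof -
  have fin: "finite V" and xyV: "x \<in> V" "y \<in> V" "x \<noteq> y" using V e by (auto simp: simple_graph_def)
  have nb: "z \<in> neighbours E t \<Longrightarrow> z \<in> V \<and> z \<noteq> t \<and> {t, z} \<in> E \<and> {z, t} \<in> E" for z t
    using neighbours_subset[OF V, of t] by (auto simp: neighbours_def insert_commute)
  have fxy: "f x - f y = w {x, y}" using f by (simp add: edge_potential_def)
  define p where "p = (if u = x then [x] else [u, x])"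
  define q where "q = (if v = y then [y] else [y, v])"
  have fu: "u = x \<or> u \<in> V \<and> u \<noteq> x \<and> u \<noteq> y \<and> {u, x} \<in> E \<and> f u - f x = w {u, x}"
    using u f nb[of u x] by (auto simp: edge_potential_def insert_commute)
  have fv: "v = y \<or> v \<in> V \<and> v \<noteq> x \<and> v \<noteq> y \<and> {y, v} \<in> E \<and> f y - f v = w {y, v}"
    using v f nb[of v y] by (auto simp: edge_potential_def insert_commute)
  \<comment> \<open>The strict descent from \<open>x\<close> to \<open>y\<close> separates
    \<open>u\<close> from \<open>v\<close>, as needed for the concatenated path to be free of
    repetitions.\<close>
  have "f v \<le> f y" "f y < f x" "f x \<le> f u"
    using fu fv pos[of "{u, x}"] pos[of "{y, v}"] pos[OF e] fxy by auto
  then have uv: "u \<noteq> v" by auto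
  have "graph_path V E u (p @ q) v"
    using fu fv uv xyV e by (auto simp: graph_path_def p_def q_def)
  from graph_dist_le[OF fin this, of w] have "graph_dist V E w u v \<le> path_weight w (p @ q)" .
  also have "\<dots> = f u - f v"
    using fu fv fxy by (auto simp: p_def q_def path_weight_Cons2)
  finally show ?thesis .
qed

text \<open>The maximal coupling moves mass only between pairs on which \<open>f\<close> is tight,
  so \<open>wasserstein_eqI\<close> applies and the cost is a difference of two explicit
  means.\<close>

lemma wasserstein_lazy_step_edge:
  assumes G: "connected_graph V E" and e: "{x, y} \<in> E" and pos: "\<And>e. e \<in> E \<Longrightarrow> w e > 0"
    and f: "edge_potential E w x y f" and \<alpha>: "1 / 2 < \<alpha>" "\<alpha> < 1"
  shows "wasserstein (graph_dist V E w) (lazy_step E \<alpha> x) (lazy_step E \<alpha> y) =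
    w {x, y} + (1 - \<alpha>) * (\<Sum>e'\<in>E. ricci_matrix E {x, y} e' * w e')"
proof -
  have V: "simple_graph V E" and fin: "finite V" using G by (auto simp: connected_graph_def simple_graph_def)
  have xy: "x \<in> V" "y \<in> V" "x \<noteq> y" using V e by (auto simp: simple_graph_def)
  have lip: "f u - f v \<le> w {u, v}" if "{u, v} \<in> E" for u v using f that by (simp add: edge_potential_def)
  have fxy: "f x - f y = w {x, y}" using f by (simp add: edge_potential_def)
  have nbx: "y \<in> neighbours E x" and nby: "x \<in> neighbours E y"
    using e by (auto simp: neighbours_def insert_commute)
  note nfin = neighbours_subset(2)[OF V]
  have nout: "z \<notin> neighbours E z" for z using neighbours_subset(1)[OF V, of z] by auto
  have deg: "vdegree E x \<ge> 1" "vdegree E y \<ge> 1"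
    using nbx nby nfin by (auto simp: vdegree_def Suc_le_eq card_gt_0_iff)
  have px: "pmf (lazy_step E \<alpha> x) z = (if z = x then \<alpha> else if z \<in> neighbours E x then (1 - \<alpha>) / vdegree E x else 0)" for z
    using \<alpha> nfin nout nbx by (intro pmf_lazy_step) auto
  have py: "pmf (lazy_step E \<alpha> y) z = (if z = y then \<alpha> else if z \<in> neighbours E y then (1 - \<alpha>) / vdegree E y else 0)" for z
    using \<alpha> nfin nout nby by (intro pmf_lazy_step) auto
  \<comment> \<open>Here \<alpha> > 1/2 enters: the step from \<open>x\<close> puts less mass on
    \<open>y\<close> than the step from \<open>y\<close> keeps there, so \<open>y\<close> is never a
    source of transported mass, and symmetrically \<open>x\<close> is never a target.\<close>
  have small: "(1 - \<alpha>) / vdegree E z < \<alpha>" if "vdegree E z \<ge> 1" for z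
  proof -
    have "(1 - \<alpha>) / vdegree E z \<le> (1 - \<alpha>) / 1" using \<alpha> that by (intro divide_left_mono) auto
    then show ?thesis using \<alpha> by simp
  qed
  have supp: "set_pmf (lazy_step E \<alpha> x) \<subseteq> V" "set_pmf (lazy_step E \<alpha> y) \<subseteq> V"
    using xy neighbours_subset(1)[OF V, of x] neighbours_subset(1)[OF V, of y]
    by (auto simp: set_pmf_iff px py split: if_splits)
  have nonneg: "\<not> (1 - \<alpha>) / real m < 0" for m using \<alpha> by (simp add: not_less)
  have big_x: "u \<in> insert x (neighbours E x - {y})" if "pmf (lazy_step E \<alpha> y) u < pmf (lazy_step E \<alpha> x) u" for u
    using that \<alpha> small[OF deg(1)] nonneg xy by (auto simp: px py split: if_splits)
  have big_y: "v \<in> insert y (neighbours E y - {x})" if "pmf (lazy_step E \<alpha> x) v < pmf (lazy_step E \<alpha> y) v" for v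
    using that \<alpha> small[OF deg(2)] nonneg xy by (auto simp: px py split: if_splits)
  obtain \<pi> where \<pi>: "map_pmf fst \<pi> = lazy_step E \<alpha> x" "map_pmf snd \<pi> = lazy_step E \<alpha> y"
    and off: "\<And>u v. (u, v) \<in> set_pmf \<pi> \<Longrightarrow> u = v \<or>
      pmf (lazy_step E \<alpha> y) u < pmf (lazy_step E \<alpha> x) u \<and> pmf (lazy_step E \<alpha> x) v < pmf (lazy_step E \<alpha> y) v"
    using exists_coupling_off_diagonal[OF finite_subset[OF supp(1) fin] finite_subset[OF supp(2) fin]]
    by blast
  have tight: "graph_dist V E w u v \<le> f u - f v" if uv: "(u, v) \<in> set_pmf \<pi>" for u v
  proof (cases "u = v")
    case True
    have "u \<in> set_pmf (map_pmf fst \<pi>)" using uv by force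
    then have "graph_path V E u [u] u" using supp \<pi> by (auto simp: graph_path_def)
    from graph_dist_le[OF fin this, of w] show ?thesis using True by simp
  next
    case False
    then show ?thesis
      using off[OF uv] big_x big_y V e pos f by (intro graph_dist_le_edge_potential) auto
  qed
  \<comment> \<open>Every neighbour \<open>u\<close> other than \<open>y\<close> lies
    \<open>w {x, u}\<close> above \<open>f x\<close>, while \<open>y\<close> lies
    \<open>w {x, y}\<close> below it; correcting that one sign subtracts the weight twice.\<close>
  have sx: "(\<Sum>u\<in>neighbours E x. f u) = vdegree E x * f x + ((\<Sum>u\<in>neighbours E x. w {x, u}) - 2 * w {x, y})"
  proof -
    have "(\<Sum>u\<in>neighbours E x. f u) = f y + (\<Sum>u\<in>neighbours E x - {y}. f x + w {x, u})"
      using nbx nfin f by (subst sum.remove[of _ y]) (auto simp: edge_potential_def algebra_simps intro!: sum.cong)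
    also have "\<dots> = f y + (real (vdegree E x) - 1) * f x + ((\<Sum>u\<in>neighbours E x. w {x, u}) - w {x, y})"
      using nbx nfin deg by (simp add: sum.distrib sum_diff1 vdegree_def of_nat_diff)
    finally show ?thesis using fxy by (simp add: algebra_simps)
  qed
  have sy: "(\<Sum>v\<in>neighbours E y. f v) = vdegree E y * f y - ((\<Sum>v\<in>neighbours E y. w {y, v}) - 2 * w {x, y})"
  proof -
    have "(\<Sum>v\<in>neighbours E y. f v) = f x + (\<Sum>v\<in>neighbours E y - {x}. f y - w {y, v})"
      using nby nfin f by (subst sum.remove[of _ x]) (auto simp: edge_potential_def algebra_simps intro!: sum.cong)
    also have "\<dots> = f x + (real (vdegree E y) - 1) * f y - ((\<Sum>v\<in>neighbours E y. w {y, v}) - w {y, x})"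
      using nby nfin deg by (simp add: sum_subtractf sum_diff1 vdegree_def of_nat_diff)
    finally show ?thesis using fxy by (simp add: algebra_simps insert_commute)
  qed
  have avg: "(d * a + s) / d = a + s / d" "(d * a - s) / d = a - s / d" if "d \<noteq> 0" for d a s :: real
    using that by (simp_all add: field_simps)
  \<comment> \<open>With \<open>p\<close> and \<open>q\<close> the two summands of
    \<open>sum_ricci_matrix\<close>, the cost is exactly affine in \<alpha>.\<close>
  have alg: "\<alpha> * a + (1 - \<alpha>) * (a + p) - (\<alpha> * b + (1 - \<alpha>) * (b - q)) = a - b + (1 - \<alpha>) * (p + q)"
    for a b p q :: real by (simp add: algebra_simps)
  have "wasserstein (graph_dist V E w) (lazy_step E \<alpha> x) (lazy_step E \<alpha> y) =
    measure_pmf.expectation (lazy_step E \<alpha> x) f - measure_pmf.expectation (lazy_step E \<alpha> y) f"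
  proof (rule wasserstein_eqI[OF _ _ _ \<pi> tight])
    show "finite (set_pmf (lazy_step E \<alpha> x))" "finite (set_pmf (lazy_step E \<alpha> y))"
      using supp fin by (auto intro: finite_subset)
    show "f u - f v \<le> graph_dist V E w u v"
      if "u \<in> set_pmf (lazy_step E \<alpha> x)" "v \<in> set_pmf (lazy_step E \<alpha> y)" for u v
      using that supp G lip by (intro le_graph_dist) auto
  qed
  also have "measure_pmf.expectation (lazy_step E \<alpha> x) f =
      \<alpha> * f x + (1 - \<alpha>) * ((\<Sum>u\<in>neighbours E x. f u) / vdegree E x)"
    using \<alpha> nfin nbx by (subst expectation_lazy_step) auto
  also have "(\<Sum>u\<in>neighbours E x. f u) / vdegree E x =
      f x + ((\<Sum>u\<in>neighbours E x. w {x, u}) - 2 * w {x, y}) / vdegree E x"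
    unfolding sx using deg by (intro avg) auto
  also have "measure_pmf.expectation (lazy_step E \<alpha> y) f =
      \<alpha> * f y + (1 - \<alpha>) * ((\<Sum>u\<in>neighbours E y. f u) / vdegree E y)"
    using \<alpha> nfin nby by (subst expectation_lazy_step) auto
  also have "(\<Sum>v\<in>neighbours E y. f v) / vdegree E y =
      f y - ((\<Sum>v\<in>neighbours E y. w {y, v}) - 2 * w {x, y}) / vdegree E y"
    unfolding sy using deg by (intro avg) auto
  finally show ?thesis unfolding sum_ricci_matrix[OF V e] alg fxy .
qed

text \<open>For \<alpha> between 1/2 and 1 the quotient defining the curvature is constantly
  \<open>- l\<close>, so the limit is that of an eventually constant function.\<close>

lemma discrete_Einstein_metricI:
  assumes G: "connected_graph V E" and pos: "\<And>e. e \<in> E \<Longrightarrow> w e > 0"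
    and eig: "\<And>e. e \<in> E \<Longrightarrow> (\<Sum>e'\<in>E. ricci_matrix E e e' * w e') = l * w e"
    and pot: "\<And>x y. {x, y} \<in> E \<Longrightarrow> \<exists>f. edge_potential E w x y f"
  shows "discrete_Einstein_metric V E w (- l)"
proof -
  have "has_LLY_curvature V E w x y (- l)" if e: "{x, y} \<in> E" for x y
  proof -
    obtain f where f: "edge_potential E w x y f" using pot[OF e] by blast
    have dist: "graph_dist V E w x y = w {x, y}"
      using f by (intro graph_dist_edge[OF G e, of f]) (auto simp: edge_potential_def)
    have "alpha_curvature V E w \<alpha> x y / (1 - \<alpha>) = - l" if "1 / 2 < \<alpha>" "\<alpha> < 1" for \<alpha>
    proof -
      have "wasserstein (graph_dist V E w) (lazy_step E \<alpha> x) (lazy_step E \<alpha> y) =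
          w {x, y} + (1 - \<alpha>) * (l * w {x, y})"
        unfolding eig[OF e, symmetric] using G e pos f that by (intro wasserstein_lazy_step_edge)
      then show ?thesis
        unfolding alpha_curvature_def dist using pos[OF e] that by (simp add: field_simps)
    qed
    then have "\<forall>\<^sub>F \<alpha> in at_left 1. alpha_curvature V E w \<alpha> x y / (1 - \<alpha>) = - l"
      by (intro eventually_at_leftI[of "1 / 2"]) auto
    then show ?thesis unfolding has_LLY_curvature_def by (rule tendsto_eventually)
  qed
  then show ?thesis using pos by (simp add: discrete_Einstein_metric_def)
qed


section \<open>The largest eigenvalue of a symmetric matrix\<close>

text \<open>Eigenvectors for distinct eigenvalues are orthogonal, so Bessel's inequality bounds their number.\<close>

lemma finite_eigenvalues_symmetric:
  fixes A :: "'i \<Rightarrow> 'i \<Rightarrow> real"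
  assumes fin: "finite I" and sym: "\<And>i j. A i j = A j i"
  shows "finite {k. eigenvalue_on I A k}"
proof -
  have bound: "card K \<le> card I" if K: "finite K" "K \<subseteq> {k. eigenvalue_on I A k}" for K
  proof -
    have "\<forall>k\<in>K. \<exists>v. (\<Sum>i\<in>I. v i * v i) = 1 \<and> (\<forall>i\<in>I. (\<Sum>j\<in>I. A i j * v j) = k * v i)"
    proof
      fix k assume "k \<in> K"
      then obtain v where v: "\<exists>i\<in>I. v i \<noteq> 0" "\<And>i. i \<in> I \<Longrightarrow> (\<Sum>j\<in>I. A i j * v j) = k * v i"
        using K unfolding eigenvalue_on_def by blast
      define N where "N = (\<Sum>i\<in>I. v i * v i)"
      have N: "N > 0" unfolding N_def using v(1) fin
        by (metis (no_types, lifting) sum_pos2 not_real_square_gt_zero zero_le_square)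
      let ?u = "\<lambda>i. v i / sqrt N"
      have "(\<Sum>i\<in>I. ?u i * ?u i) = 1"
        using N by (simp add: sum_divide_distrib[symmetric] N_def[symmetric])
      moreover have "\<forall>i\<in>I. (\<Sum>j\<in>I. A i j * ?u j) = k * ?u i"
        using v(2) by (simp add: sum_divide_distrib[symmetric])
      ultimately show "\<exists>v. (\<Sum>i\<in>I. v i * v i) = 1 \<and> (\<forall>i\<in>I. (\<Sum>j\<in>I. A i j * v j) = k * v i)"
        by (intro exI[of _ ?u] conjI)
    qed
    then obtain u where unit: "\<And>k. k \<in> K \<Longrightarrow> (\<Sum>i\<in>I. u k i * u k i) = 1"
      and eig: "\<And>k i. k \<in> K \<Longrightarrow> i \<in> I \<Longrightarrow> (\<Sum>j\<in>I. A i j * u k j) = k * u k i"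
      by metis
    have orth: "(\<Sum>i\<in>I. u k i * u l i) = 0" if "k \<in> K" "l \<in> K" "k \<noteq> l" for k l
    proof -
      have "k * (\<Sum>i\<in>I. u k i * u l i) = (\<Sum>i\<in>I. (\<Sum>j\<in>I. A i j * u k j) * u l i)"
        using eig that by (simp add: sum_distrib_left mult.assoc)
      also have "\<dots> = (\<Sum>i\<in>I. \<Sum>j\<in>I. A i j * u k j * u l i)" by (simp add: sum_distrib_right)
      also have "\<dots> = (\<Sum>j\<in>I. \<Sum>i\<in>I. A i j * u k j * u l i)" by (rule sum.swap)
      also have "\<dots> = (\<Sum>j\<in>I. (\<Sum>i\<in>I. A j i * u l i) * u k j)"
        by (simp add: sum_distrib_left sum_distrib_right sym ac_simps)
      also have "\<dots> = l * (\<Sum>i\<in>I. u k i * u l i)"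
        using eig that by (simp add: sum_distrib_left mult.assoc mult.commute mult.left_commute)
      finally show ?thesis using that by simp
    qed
    \<comment> \<open>Bessel's inequality for the unit vector \<open>D\<close> at \<open>i\<close>:
      its coefficient along \<open>u k\<close> is \<open>u k i\<close>, and \<open>S\<close> is its
      orthogonal projection onto the span of the vectors \<open>u k\<close>.\<close>
    have bessel: "(\<Sum>k\<in>K. u k i * u k i) \<le> 1" if i: "i \<in> I" for i
    proof -
      define S where "S j = (\<Sum>k\<in>K. u k i * u k j)" for j
      define D where "D j = (if j = i then 1 else 0::real)" for j
      have D: "(\<Sum>j\<in>I. D j * h j) = h i" for h
      proof -
        have "(\<Sum>j\<in>I. D j * h j) = (\<Sum>j\<in>I. if j = i then h j else 0)"
          by (intro sum.cong) (auto simp: D_def)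
        then show ?thesis using i fin by simp
      qed
      have SS: "(\<Sum>j\<in>I. S j * S j) = S i"
      proof -
        have "(\<Sum>j\<in>I. S j * S j) = (\<Sum>j\<in>I. \<Sum>k\<in>K. \<Sum>l\<in>K. (u k i * u l i) * (u k j * u l j))"
          by (simp add: S_def sum_product mult.assoc mult.left_commute)
        also have "\<dots> = (\<Sum>k\<in>K. \<Sum>j\<in>I. \<Sum>l\<in>K. (u k i * u l i) * (u k j * u l j))" by (rule sum.swap)
        also have "\<dots> = (\<Sum>k\<in>K. \<Sum>l\<in>K. \<Sum>j\<in>I. (u k i * u l i) * (u k j * u l j))"
          by (intro sum.cong refl sum.swap)
        also have "\<dots> = (\<Sum>k\<in>K. \<Sum>l\<in>K. (u k i * u l i) * (if k = l then 1 else 0))"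
          using unit orth by (intro sum.cong refl) (auto simp: sum_distrib_left[symmetric])
        also have "\<dots> = S i" using K by (simp add: S_def if_distrib cong: if_cong)
        finally show ?thesis .
      qed
      have "0 \<le> (\<Sum>j\<in>I. (D j - S j) * (D j - S j))" by (intro sum_nonneg) auto
      also have "\<dots> = (\<Sum>j\<in>I. D j * D j) - 2 * (\<Sum>j\<in>I. D j * S j) + (\<Sum>j\<in>I. S j * S j)"
        by (simp add: algebra_simps sum.distrib sum_subtractf sum_distrib_left)
      also have "\<dots> = 1 - S i" unfolding D SS by (simp add: D_def)
      finally show ?thesis by (simp add: S_def)
    qed
    \<comment> \<open>Counting the total squared mass of the unit vectors by rows and by columns
      compares \<open>card K\<close> with \<open>card I\<close>.\<close>
    have "real (card K) = (\<Sum>k\<in>K. \<Sum>i\<in>I. u k i * u k i)" using unit by simp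
    also have "\<dots> = (\<Sum>i\<in>I. \<Sum>k\<in>K. u k i * u k i)" by (rule sum.swap)
    also have "\<dots> \<le> (\<Sum>i\<in>I. 1)" using bessel by (intro sum_mono)
    finally show ?thesis by simp
  qed
  show ?thesis
  proof (rule ccontr)
    assume "infinite {k. eigenvalue_on I A k}"
    then obtain K where "K \<subseteq> {k. eigenvalue_on I A k}" "finite K" "card K = Suc (card I)"
      using infinite_arbitrarily_large by blast
    then show False using bound[of K] by simp
  qed
qed

text \<open>
  Perron--Frobenius: at an index maximising \<open>\<bar>v i\<bar> / w i\<close> the eigenvalue equation of \<open>v\<close> is
  dominated by that of the positive eigenvector \<open>w\<close>.
\<close>

lemma eigenvalue_le_positive_eigenvector:
  fixes A :: "'i \<Rightarrow> 'i \<Rightarrow> real"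
  assumes fin: "finite I"
    and off: "\<And>i j. i \<in> I \<Longrightarrow> j \<in> I \<Longrightarrow> i \<noteq> j \<Longrightarrow> A i j \<ge> 0"
    and pos: "\<And>i. i \<in> I \<Longrightarrow> w i > 0"
    and eig: "\<And>i. i \<in> I \<Longrightarrow> (\<Sum>j\<in>I. A i j * w j) = l * w i"
    and k: "eigenvalue_on I A k"
  shows "k \<le> l"
proof -
  obtain v where v: "\<exists>i\<in>I. v i \<noteq> 0" "\<And>i. i \<in> I \<Longrightarrow> (\<Sum>j\<in>I. A i j * v j) = k * v i"
    using k by (auto simp: eigenvalue_on_def)
  obtain i where i: "i \<in> I" and imax: "\<And>j. j \<in> I \<Longrightarrow> \<bar>v j\<bar> / w j \<le> \<bar>v i\<bar> / w i"
  proof -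
    let ?S = "(\<lambda>j. \<bar>v j\<bar> / w j) ` I"
    have S: "finite ?S" "?S \<noteq> {}" using fin v(1) by auto
    from Max_in[OF this] obtain i where "i \<in> I" "Max ?S = \<bar>v i\<bar> / w i" by auto
    then show ?thesis using that[of i] Max_ge[OF S(1)] by auto
  qed
  define c where "c = \<bar>v i\<bar> / w i"
  define s where "s = sgn (v i)"
  have vj: "\<bar>v j\<bar> \<le> c * w j" if "j \<in> I" for j
    using imax[OF that] pos[OF that] by (simp add: c_def pos_divide_le_eq)
  have "c > 0"
  proof -
    obtain j where "j \<in> I" "v j \<noteq> 0" using v(1) by auto
    then have "0 < c * w j" using vj[of j] by linarith
    then show ?thesis using pos[OF \<open>j \<in> I\<close>] by (simp add: zero_less_mult_iff)
  qed
  have s: "\<bar>s\<bar> \<le> 1" "s * v i = c * w i" using pos[OF i] by (auto simp: s_def c_def sgn_if)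
  have "k * (c * w i) = s * (k * v i)" using s(2) by (metis mult.left_commute)
  also have "\<dots> = (\<Sum>j\<in>I. A i j * (s * v j))"
    unfolding v(2)[OF i, symmetric] by (simp add: sum_distrib_left mult.left_commute)
  also have "\<dots> \<le> (\<Sum>j\<in>I. A i j * (c * w j))"
  proof (intro sum_mono)
    fix j assume j: "j \<in> I"
    show "A i j * (s * v j) \<le> A i j * (c * w j)"
    \<comment> \<open>Diagonal entries may be negative, but at \<open>j = i\<close> the two terms
      coincide, so only off-diagonal signs matter.\<close>
    proof (cases "j = i")
      case False
      have "\<bar>s * v j\<bar> \<le> 1 * \<bar>v j\<bar>" unfolding abs_mult using s(1) by (intro mult_right_mono) auto
      then have "s * v j \<le> c * w j" using vj[OF j] by linarith
      then show ?thesis using off[OF i j] False by (intro mult_left_mono) auto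
    qed (simp add: s(2))
  qed
  also have "\<dots> = c * (l * w i)" unfolding eig[OF i, symmetric] by (simp add: sum_distrib_left mult.left_commute)
  finally have "k * (c * w i) \<le> l * (c * w i)" by (simp add: mult.left_commute mult.assoc)
  then show ?thesis using \<open>c > 0\<close> pos[OF i] by simp
qed

text \<open>Symmetry makes the set of eigenvalues finite, so \<open>Max\<close> is meaningful; the
  positive eigenvector both attains \<open>l\<close> and bounds all other eigenvalues.\<close>

lemma lambda_max_eqI:
  fixes A :: "'i \<Rightarrow> 'i \<Rightarrow> real"
  assumes "finite I" "I \<noteq> {}" "\<And>i j. A i j = A j i"
    and "\<And>i j. i \<in> I \<Longrightarrow> j \<in> I \<Longrightarrow> i \<noteq> j \<Longrightarrow> A i j \<ge> 0"
    and "\<And>i. i \<in> I \<Longrightarrow> w i > 0"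
    and "\<And>i. i \<in> I \<Longrightarrow> (\<Sum>j\<in>I. A i j * w j) = l * w i"
  shows "lambda_max I A = l"
  unfolding lambda_max_def
proof (rule Max_eqI)
  show "finite {k. eigenvalue_on I A k}" using assms by (intro finite_eigenvalues_symmetric)
  show "k \<le> l" if "k \<in> {k. eigenvalue_on I A k}" for k
    using eigenvalue_le_positive_eigenvector[of I A w l k] assms that by auto
  have "\<exists>i\<in>I. w i \<noteq> 0" using assms(2,5) by fastforce
  then show "l \<in> {k. eigenvalue_on I A k}" using assms(6) by (auto simp: eigenvalue_on_def)
qed


section \<open>The function \<open>F\<close>\<close>

text \<open>With \<open>s = sqrt (d - 1)\<close> and \<open>r = sqrt 2\<close> the claim becomes
  nonnegativity of a multiple of the square of \<open>s - (r + 1)\<close>. Equality at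
  \<open>s = 1 + r\<close> gives \<open>d = 4 + 2 * r\<close>, where the value of
  \<open>F_fun\<close> is \<open>r - 1\<close>.\<close>

lemma F_fun_le_max:
  assumes "d \<ge> 1"
  shows "F_fun d \<le> F_fun (4 + 2 * sqrt 2)"
proof -
  have r: "sqrt 2 * sqrt 2 = (2::real)" "sqrt 2 > (1::real)" by auto
  define r :: real where "r = sqrt 2"
  define s where "s = sqrt (d - 1)"
  have s: "s * s = d - 1" using assms by (simp add: s_def)
  have rr: "r * r = 2" "r > 1" using r by (auto simp: r_def)
  have "sqrt (4 + 2 * r - 1) = 1 + r"
    using rr by (intro real_sqrt_unique) (auto simp: power2_eq_square algebra_simps)
  then have "F_fun (4 + 2 * r) = 2 * r / (4 + 2 * r)" by (simp add: F_fun_def)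
  also have "\<dots> = r - 1" using rr by (simp add: field_simps)
  finally have top: "F_fun (4 + 2 * r) = r - 1" .
  have "0 \<le> (r - 1) * ((s - (r + 1)) * (s - (r + 1)))" using rr by (intro mult_nonneg_nonneg zero_le_square) auto
  also have "\<dots> = (r - 1) * (s * s) - 2 * ((r * r - 1) * s) + (r * r - 1) * (r + 1)"
    by (simp add: algebra_simps)
  also have "\<dots> = (r - 1) * d - 2 * (s - 1)" unfolding rr s by (simp add: algebra_simps)
  finally have "2 * (s - 1) / d \<le> r - 1" using assms by (simp add: divide_le_eq)
  then show ?thesis using top by (simp add: F_fun_def s_def r_def)
qed

lemma F_fun_7: "F_fun 7 = 2 * (sqrt 6 - 1) / 7"
  by (simp add: F_fun_def)

text \<open>
  With \<open>s = sqrt (n - 1)\<close> and \<open>r = sqrt 6\<close>, the inequality is quadratic in \<open>s\<close> with roots \<open>r\<close>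
  and \<open>(r + 1) / (r - 1)\<close>, and the latter lies between \<open>sqrt 5\<close> and \<open>sqrt 6\<close>.
\<close>

lemma F_fun_le_7:
  fixes n :: int
  assumes "n \<ge> 1"
  shows "F_fun (of_int n) \<le> F_fun 7"
proof -
  define r :: real where "r = sqrt 6"
  define q :: real where "q = sqrt 5"
  define s where "s = sqrt (of_int n - 1)"
  have s: "s * s = of_int n - 1" "s \<ge> 0" using assms by (auto simp: s_def)
  have r: "r * r = 6" "2 < r" "r < 2.45"
    unfolding r_def by (simp, rule real_less_rsqrt, simp, rule real_less_lsqrt) (auto simp: power2_eq_square)
  have q: "q < 2.24" unfolding q_def by (rule real_less_lsqrt) (auto simp: power2_eq_square)
  have "0 \<le> (s - r) * ((r - 1) * s - (r + 1))"
  proof (cases "n \<ge> 7")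
    case True
    then have "s \<ge> r" unfolding s_def r_def by (intro real_sqrt_le_mono) linarith
    moreover have "(r - 1) * r \<le> (r - 1) * s" using \<open>s \<ge> r\<close> r by (intro mult_left_mono) auto
    moreover have "(r - 1) * r = 6 - r" using r by (simp add: algebra_simps)
    ultimately show ?thesis using r by (intro mult_nonneg_nonneg) auto
  next
    case False
    \<comment> \<open>Integrality gives \<open>n \<le> 6\<close>, hence
      \<open>s \<le> sqrt 5 < 2.24\<close>; then \<open>(r - 1) * 2.24 \<le> r + 1\<close> because
      \<open>r < 2.45\<close>.\<close>
    then have sq: "s \<le> q" unfolding s_def q_def by (intro real_sqrt_le_mono) linarith
    then have "(r - 1) * s \<le> (r - 1) * 2.24" using r q by (intro mult_left_mono) auto
    then have "(r - 1) * s \<le> r + 1" using r by (simp add: algebra_simps)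
    moreover have "s \<le> r" using sq unfolding q_def r_def by (smt (verit) real_sqrt_le_mono)
    ultimately show ?thesis by (intro mult_nonpos_nonpos) auto
  qed
  also have "\<dots> = (r - 1) * (s * s) - (1 + r * r) * s + r + r * r" by (simp add: algebra_simps)
  also have "\<dots> = (r - 1) * of_int n - 7 * (s - 1)" unfolding r(1) s(1) by (simp add: algebra_simps)
  finally have "2 * (s - 1) / of_int n \<le> 2 * (r - 1) / 7" using assms by (simp add: field_simps)
  then show ?thesis by (simp add: F_fun_def s_def r_def)
qed

lemma F_fun_pos: "d > 2 \<Longrightarrow> F_fun d > 0"
  by (simp add: F_fun_def)

lemma filterlim_F_fun: "filterlim F_fun (at_right 0) at_top"
  unfolding F_fun_def by real_asymp


section \<open>The graphs \<open>S\<^bsub>g,d\<^esub>\<close>\<close>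

text \<open>If \<open>z\<close> already occurs on \<open>p\<close>, the path is cut off at
  \<open>z\<close> to keep its vertices distinct; otherwise \<open>z\<close> is appended.\<close>

lemma graph_path_extend:
  assumes p: "graph_path V E x p y" and e: "{y, z} \<in> E" "z \<in> V"
  shows "\<exists>p. graph_path V E x p z"
proof (cases "z \<in> set p")
  case True
  then obtain xs ys where "p = xs @ z # ys" by (meson split_list)
  then have xs: "p = (xs @ [z]) @ ys" by simp
  then have "successively (\<lambda>u v. {u, v} \<in> E) (xs @ [z])"
    using p unfolding graph_path_def by (metis successively_append_iff)
  then have "graph_path V E x (xs @ [z]) z"
    using p xs by (cases xs) (auto simp: graph_path_def)
  then show ?thesis ..
next
  case False
  then have "graph_path V E x (p @ [z]) z"
    using p e by (auto simp: graph_path_def successively_append_iff)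
  then show ?thesis ..
qed

lemma Suc_mod_neq:
  assumes "i < g" "g \<ge> 2"
  shows "Suc i mod g \<noteq> i"
  using assms by (cases "Suc i = g") auto

lemma S_edge_cases:
  assumes "g \<ge> 2"
  shows "{(i, j), (k, l)} \<in> S_edges g d \<longleftrightarrow> i < g \<and> k < g \<and>
    (j = 0 \<and> l = 0 \<and> (k = Suc i mod g \<or> i = Suc k mod g) \<or>
     i = k \<and> (j = 0 \<and> l \<in> {1..d - 2} \<or> l = 0 \<and> j \<in> {1..d - 2}))"
proof -
  have "Suc i mod g < g" for i using assms by simp
  then show ?thesis unfolding S_edges_def by (auto simp: doubleton_eq_iff)
qed

lemma simple_graph_S:
  assumes "g \<ge> 2"
  shows "simple_graph (S_verts g d) (S_edges g d)"
  unfolding simple_graph_def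
proof (intro conjI ballI)
  show "finite (S_verts g d)" by (simp add: S_verts_def)
  fix e assume "e \<in> S_edges g d"
  then consider i where "i < g" "e = {(i, 0), (Suc i mod g, 0)}"
    | i j where "i < g" "j \<in> {1..d - 2}" "e = {(i, 0), (i, j)}"
    by (auto simp: S_edges_def)
  then have "e \<subseteq> S_verts g d \<and> card e = 2"
  proof cases
    case 1
    then have "i \<noteq> Suc i mod g" using assms Suc_mod_neq[of i g] by auto
    moreover have "Suc i mod g < g" using assms by simp
    ultimately show ?thesis using 1 by (simp add: S_verts_def)
  qed (auto simp: S_verts_def)
  then show "e \<subseteq> S_verts g d" "card e = 2" by auto
qed

text \<open>The cyclic predecessor is written with an added \<open>g\<close> so that natural
  subtraction does not truncate at \<open>i = 0\<close>.\<close>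

lemma Suc_mod_eq_iff_pred:
  assumes "i < g" "k < g"
  shows "i = Suc k mod g \<longleftrightarrow> k = (i + g - 1) mod g"
proof
  assume "i = Suc k mod g"
  then show "k = (i + g - 1) mod g" using assms by (cases "Suc k = g") auto
next
  assume "k = (i + g - 1) mod g"
  then show "i = Suc k mod g" using assms by (cases i) (auto simp: mod_Suc)
qed

lemma neighbours_S_cycle:
  assumes "g \<ge> 2" "i < g"
  shows "neighbours (S_edges g d) (i, 0) =
    insert (Suc i mod g, 0) (insert ((i + g - 1) mod g, 0) ({i} \<times> {1..d - 2}))"
proof (intro set_eqI)
  fix z :: "nat \<times> nat"
  obtain k l where z: "z = (k, l)" by fastforce
  have "Suc i mod g < g" "(i + g - 1) mod g < g" using assms by auto
  then show "z \<in> neighbours (S_edges g d) (i, 0) \<longleftrightarrow>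
      z \<in> insert (Suc i mod g, 0) (insert ((i + g - 1) mod g, 0) ({i} \<times> {1..d - 2}))"
    using assms Suc_mod_eq_iff_pred[of i g k] unfolding z neighbours_def
    by (auto simp: S_edge_cases)
qed

lemma neighbours_S_leaf:
  assumes "g \<ge> 2" "i < g" "j \<in> {1..d - 2}"
  shows "neighbours (S_edges g d) (i, j) = {(i, 0)}"
  using assms by (auto simp: neighbours_def S_edge_cases)

text \<open>For \<open>g = 2\<close> successor and predecessor coincide. The fact serves both the
  degrees in \<open>S_edges g d\<close> and the index arithmetic of an arbitrary cycle in
  it.\<close>

lemma succ_pred_mod_neq:
  assumes "g \<ge> 3" "i < g"
  shows "Suc i mod g \<noteq> (i + g - 1) mod g"
  using assms by (cases "Suc i = g"; cases i) (auto simp: mod_Suc)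

lemma vdegree_S:
  assumes "g \<ge> 3" "i < g" "d \<ge> 2"
  shows "vdegree (S_edges g d) (i, 0) = d"
    and "j \<in> {1..d - 2} \<Longrightarrow> vdegree (S_edges g d) (i, j) = 1"
  using assms succ_pred_mod_neq[of g i]
  by (auto simp: vdegree_def neighbours_S_cycle neighbours_S_leaf card_insert_if card_cartesian_product)

text \<open>Go from \<open>x\<close> to the cycle, around it to the vertex below \<open>y\<close>,
  and out to \<open>y\<close>.\<close>

lemma connected_graph_S:
  assumes g: "g \<ge> 2"
  shows "connected_graph (S_verts g d) (S_edges g d)"
proof -
  let ?V = "S_verts g d" and ?E = "S_edges g d"
  have "\<exists>p. graph_path ?V ?E x p y" if x: "x \<in> ?V" and y: "y \<in> ?V" for x y
  proof -
    obtain i j k l where ijkl: "x = (i, j)" "y = (k, l)" "i < g" "k < g" "j \<le> d - 2" "l \<le> d - 2"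
      using x y by (auto simp: S_verts_def)
    note * = graph_path_extend[of ?V ?E x]
    have base: "\<exists>p. graph_path ?V ?E x p (i, 0)"
    proof -
      have "graph_path ?V ?E x [x] x" using x by (simp add: graph_path_def)
      then show ?thesis
        using *[of "[x]" x "(i, 0)"] ijkl g by (cases "j = 0") (auto simp: S_edge_cases S_verts_def)
    qed
    have around: "\<exists>p. graph_path ?V ?E x p ((i + n) mod g, 0)" for n
    proof (induction n)
      case 0
      then show ?case using base ijkl by simp
    next
      case (Suc n)
      have "{((i + n) mod g, 0), ((i + Suc n) mod g, 0)} \<in> ?E" "((i + Suc n) mod g, 0) \<in> ?V"
        using g by (auto simp: S_edge_cases S_verts_def mod_Suc_eq)
      then show ?case using Suc * by blast
    qed
    have "(i + (k + g - i)) mod g = k" using ijkl by simp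
    then have "\<exists>p. graph_path ?V ?E x p (k, 0)" using around by metis
    moreover have "l = 0 \<or> {(k, 0), y} \<in> ?E" using ijkl g by (auto simp: S_edge_cases)
    ultimately show ?thesis using * y ijkl by blast
  qed
  moreover have "(0, 0) \<in> ?V" using g by (simp add: S_verts_def)
  ultimately show ?thesis using simple_graph_S[OF g] by (auto simp: connected_graph_def)
qed

text \<open>
  Every vertex of a cycle has two distinct neighbours on it, so a cycle avoids the leaves, and
  with a vertex of \<open>C\<^sub>g\<close> it contains both incident edges of \<open>C\<^sub>g\<close>.
\<close>

lemma graph_cycle_S_unique:
  assumes g: "g \<ge> 3" and C: "graph_cycle (S_verts g d) (S_edges g d) C"
  shows "C = {{(i, 0), (Suc i mod g, 0)} |i. i < g}"
proof -
  have g2: "g \<ge> 2" using g by simp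
  let ?E = "S_edges g d"
  obtain p where CE: "C \<subseteq> ?E" and len: "length p \<ge> 3" and dis: "distinct p"
    and pV: "set p \<subseteq> S_verts g d" and Cp: "C = {{p ! i, p ! (Suc i mod length p)} |i. i < length p}"
    using C by (auto simp: graph_cycle_def)
  define n where "n = length p"
  have n: "n \<ge> 3" using len by (simp add: n_def)
  have edge: "{p ! i, p ! (Suc i mod n)} \<in> C" if "i < n" for i
    using that unfolding Cp n_def by blast
  have two: "\<exists>a b. a \<noteq> b \<and> {v, a} \<in> C \<and> {v, b} \<in> C \<and> a \<in> set p \<and> b \<in> set p" if v: "v \<in> set p" for v
  proof -
    obtain m where m: "m < n" "v = p ! m" using v by (auto simp: in_set_conv_nth n_def)
    define r s where "r = (m + n - 1) mod n" and "s = Suc m mod n"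
    have lt: "s < n" "r < n" using n by (auto simp: r_def s_def)
    have ne: "s \<noteq> r" using succ_pred_mod_neq[OF n m(1)] by (simp add: r_def s_def)
    have "Suc r mod n = m" using Suc_mod_eq_iff_pred[OF m(1) lt(2)] r_def by simp
    then have "{v, p ! r} \<in> C" "{v, p ! s} \<in> C"
      using edge[OF lt(2)] edge[OF m(1)] m(2) by (simp_all add: s_def insert_commute)
    moreover have "p ! s \<noteq> p ! r" using ne lt dis by (simp add: nth_eq_iff_index_eq n_def)
    moreover have "p ! s \<in> set p" "p ! r \<in> set p" using lt by (simp_all add: n_def)
    ultimately show ?thesis by blast
  qed
  have on_cycle: "snd v = 0 \<and> fst v < g" if vp: "v \<in> set p" for v
  proof -
    obtain i j where v: "v = (i, j)" "i < g" "j \<le> d - 2" using subsetD[OF pV vp] by (auto simp: S_verts_def)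
    have False if "j \<noteq> 0"
    proof -
      have "neighbours ?E v = {(i, 0)}" using v that g2 by (simp add: neighbours_S_leaf)
      moreover obtain a b where "a \<noteq> b" "{v, a} \<in> C" "{v, b} \<in> C" using two \<open>v \<in> set p\<close> by blast
      moreover from this have "a \<in> neighbours ?E v" "b \<in> neighbours ?E v"
        using CE unfolding neighbours_def by blast+
      ultimately show False by simp
    qed
    then show ?thesis using v by auto
  qed
  have next_edge: "{(i, 0), (Suc i mod g, 0)} \<in> C \<and> (Suc i mod g, 0) \<in> set p" if ip: "(i, 0) \<in> set p" for i
  proof -
    obtain a b where ab: "a \<noteq> b" "{(i, 0), a} \<in> C" "{(i, 0), b} \<in> C" "a \<in> set p" "b \<in> set p"
      using two[OF ip] by blast
    have i: "i < g" using on_cycle[OF ip] by simp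
    have "a \<in> neighbours ?E (i, 0)" "b \<in> neighbours ?E (i, 0)"
      using ab CE by (auto simp: neighbours_def)
    \<comment> \<open>Only the successor and the predecessor are neighbours off the leaves, so of
      two distinct such neighbours one is the successor.\<close>
    then have "a = (Suc i mod g, 0) \<or> b = (Suc i mod g, 0)"
      using ab on_cycle[of a] on_cycle[of b] unfolding neighbours_S_cycle[OF g2 i] by auto
    then show ?thesis using ab by auto
  qed
  obtain i where i: "(i, 0) \<in> set p" "i < g"
  proof -
    have "p ! 0 \<in> set p" using n unfolding n_def by (intro nth_mem) linarith
    moreover from on_cycle[OF this] have "p ! 0 = (fst (p ! 0), 0)" by (simp add: prod_eq_iff)
    ultimately show ?thesis using on_cycle that by metis
  qed
  have around: "((i + m) mod g, 0) \<in> set p" for m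
  proof (induction m)
    case 0
    then show ?case using i by simp
  next
    case (Suc m)
    then show ?case using next_edge[of "(i + m) mod g"] by (simp add: mod_Suc_eq)
  qed
  have "(k, 0) \<in> set p" if "k < g" for k
    using around[of "k + g - i"] that i by simp
  then have "{{(i, 0), (Suc i mod g, 0)} |i. i < g} \<subseteq> C" using next_edge by blast
  moreover have "C \<subseteq> {{(i, 0), (Suc i mod g, 0)} |i. i < g}"
  proof
    fix e assume e: "e \<in> C"
    then obtain m where m: "m < n" "e = {p ! m, p ! (Suc m mod n)}"
      unfolding Cp n_def by blast
    have "Suc m mod n < n" using n by simp
    then have "p ! m \<in> set p" "p ! (Suc m mod n) \<in> set p" using m(1) by (simp_all add: n_def)
    from on_cycle[OF this(1)] on_cycle[OF this(2)]
    obtain k l where "p ! m = (k, 0)" "p ! (Suc m mod n) = (l, 0)"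
      by (cases "p ! m"; cases "p ! (Suc m mod n)") simp
    then have ekl: "e = {(k, 0), (l, 0)}" "{(k, 0), (l, 0)} \<in> ?E" using e CE m by auto
    then have "k < g" "l < g" "l = Suc k mod g \<or> k = Suc l mod g" using g2 by (auto simp: S_edge_cases)
    moreover have "e = {(l, 0), (k, 0)}" using ekl(1) by (simp add: insert_commute)
    ultimately show "e \<in> {{(i, 0), (Suc i mod g, 0)} |i. i < g}" using ekl(1) by blast
  qed
  ultimately show ?thesis by blast
qed

lemma unicyclic_S:
  assumes g: "g \<ge> 3"
  shows "unicyclic (S_verts g d) (S_edges g d)"
proof -
  let ?C = "{{(i, 0), (Suc i mod g, 0)} |i. i < g}" and ?p = "map (\<lambda>i. (i, 0)) [0..<g]"
  have "graph_cycle (S_verts g d) (S_edges g d) ?C"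
    unfolding graph_cycle_def
  proof (intro conjI exI[of _ ?p])
    show "?C \<subseteq> S_edges g d" by (auto simp: S_edges_def)
    show "distinct ?p" by (simp add: distinct_map inj_on_def)
    show "?C = {{?p ! i, ?p ! (Suc i mod length ?p)} |i. i < length ?p}"
      using g by (simp cong: rev_conj_cong)
  qed (use g in \<open>auto simp: S_verts_def\<close>)
  then have "\<exists>!C. graph_cycle (S_verts g d) (S_edges g d) C"
    using graph_cycle_S_unique[OF g] by (rule ex1I)
  then show ?thesis using connected_graph_S[of g d] g by (simp add: unicyclic_def)
qed


section \<open>The Einstein metric on \<open>S\<^bsub>g,d\<^esub>\<close>\<close>

text \<open>
  By rotational symmetry the eigenvalue equation reduces to two equations, for the weight
  \<open>s + 1\<close> of the cycle edges and the weight \<open>1\<close> of the leaf edges, where \<open>s = sqrt (d - 1)\<close>.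
\<close>

definition S_weight :: "nat \<Rightarrow> (nat \<times> nat) set \<Rightarrow> real" where
  "S_weight d e = (if snd ` e \<subseteq> {0} then sqrt (real d - 1) + 1 else 1)"

lemma S_weight_simps [simp]:
  "S_weight d {(i, 0), (k, 0)} = sqrt (real d - 1) + 1"
  "j > 0 \<Longrightarrow> S_weight d {(i, k), (l, j)} = 1"
  "j > 0 \<Longrightarrow> S_weight d {(l, j), (i, k)} = 1"
  by (auto simp: S_weight_def)

lemma S_weight_pos: "d \<ge> 1 \<Longrightarrow> S_weight d e > 0"
  by (simp add: S_weight_def add_nonneg_pos)

lemma ricci_S_weight:
  assumes g: "g \<ge> 3" and d: "d \<ge> 3" and e: "e \<in> S_edges g d"
  shows "(\<Sum>e'\<in>S_edges g d. ricci_matrix (S_edges g d) e e' * S_weight d e') =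
    F_fun (real d) * S_weight d e"
proof -
  define s where "s = sqrt (real d - 1)"
  have s: "s * s = real d - 1" "s \<ge> 0" using d by (auto simp: s_def)
  have F: "F_fun (real d) = 2 * (s - 1) / d" by (simp add: F_fun_def s_def)
  note G = simple_graph_S[of g d]
  have sum_cycle: "(\<Sum>u\<in>neighbours (S_edges g d) (i, 0). S_weight d {(i, 0), u}) = 2 * (s + 1) + (d - 2)"
    if "i < g" for i
  proof -
    have "(\<Sum>u\<in>{i} \<times> {1..d - 2}. S_weight d {(i, 0), u}) = (\<Sum>u\<in>{i} \<times> {1..d - 2}. 1)"
      by (intro sum.cong) auto
    then show ?thesis using that g succ_pred_mod_neq[of g i]
      by (simp add: neighbours_S_cycle card_cartesian_product s_def[symmetric])
  qed
  from e consider i where "i < g" "e = {(i, 0), (Suc i mod g, 0)}"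
    | i j where "i < g" "j \<in> {1..d - 2}" "e = {(i, 0), (i, j)}"
    by (auto simp: S_edges_def)
  then show ?thesis
  proof cases
    case 1
    have "Suc i mod g < g" using g by simp
    \<comment> \<open>At each end the two cycle edges cancel against the correction
      \<open>2 * (s + 1)\<close>, leaving the \<open>d - 2\<close> leaves of weight 1.\<close>
    then have "(\<Sum>e'\<in>S_edges g d. ricci_matrix (S_edges g d) e e' * S_weight d e') =
      (real d - 2) / d + (real d - 2) / d"
      unfolding 1(2) using e 1 g d
      by (subst sum_ricci_matrix[OF G]) (simp_all add: sum_cycle vdegree_S s_def[symmetric])
    \<comment> \<open>This factorisation is what singles out the ratio \<open>s + 1\<close> of the
      two weights.\<close>
    also have "real d - 2 = (s - 1) * (s + 1)" using s by (simp add: algebra_simps)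
    finally show ?thesis unfolding 1(2) F by (simp add: s_def[symmetric] field_simps)
  next
    case 2
    have "(\<Sum>u\<in>neighbours (S_edges g d) (i, j). S_weight d {(i, j), u}) = 1"
      using 2 g by (simp add: neighbours_S_leaf)
    \<comment> \<open>The leaf end has degree 1 and contributes \<open>1 - 2\<close>.\<close>
    then have "(\<Sum>e'\<in>S_edges g d. ricci_matrix (S_edges g d) e e' * S_weight d e') =
      (2 * (s + 1) + (real d - 2) - 2) / d - 1"
      unfolding 2(3) using e 2 g d
      by (subst sum_ricci_matrix[OF G]) (simp_all add: sum_cycle vdegree_S s_def[symmetric])
    also have "\<dots> = 2 * (s - 1) / d" using d by (simp add: field_simps)
    finally show ?thesis unfolding 2(3) F using 2 by simp
  qed
qed

lemma S_lambda_max_eq: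
  assumes "g \<ge> 3" "d \<ge> 3"
  shows "S_lambda_max g d = F_fun (real d)"
proof (rule lambda_max_eqI[where w = "S_weight d"])
  show "finite (S_edges g d)"
    using assms by (intro finite_edges[OF simple_graph_S]) simp
  have "{(0, 0), (Suc 0 mod g, 0)} \<in> S_edges g d" using assms by (auto simp: S_edge_cases)
  then show "S_edges g d \<noteq> {}" by auto
  show "ricci_matrix (S_edges g d) e e' = ricci_matrix (S_edges g d) e' e" for e e'
    by (rule ricci_matrix_commute)
  show "0 \<le> ricci_matrix (S_edges g d) e e'" if "e \<noteq> e'" for e e'
    using that by (auto simp: ricci_matrix_def intro!: sum_nonneg)
qed (use assms ricci_S_weight S_weight_pos in auto)

section \<open>Edge potentials on the cycle with leaves\<close>

text \<open>The potential is 1 at the leaf, 0 at its cycle vertex, -1 at the sibling leaves and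
  constantly minus the cycle edge weight elsewhere, hence flat on all remaining edges.\<close>

lemma edge_potential_S_leaf:
  assumes g: "g \<ge> 3" and d: "d \<ge> 1" and ij: "i < g" "j \<in> {1..d - 2}"
  shows "\<exists>f. edge_potential (S_edges g d) (S_weight d) (i, j) (i, 0) f"
proof -
  define a where "a = sqrt (real d - 1) + 1"
  have a: "a > 0" using d by (simp add: a_def add_nonneg_pos)
  define f where "f = (\<lambda>(k, l). if k \<noteq> i then - a else if l = 0 then 0 else if l = j then 1 else - 1)"
  have g2: "g \<ge> 2" using g by simp
  have ne: "Suc i mod g \<noteq> i" "(i + g - 1) mod g \<noteq> i"
    using Suc_mod_neq[of i g] Suc_mod_eq_iff_pred[of i g i] ij g by auto
  have "f u - f v \<le> S_weight d {u, v}" if "{u, v} \<in> S_edges g d" for u v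
    using that a ne g2 by (cases u; cases v) (auto simp: S_edge_cases f_def a_def[symmetric])
  moreover have "f (i, j) - f (i, 0) = S_weight d {(i, j), (i, 0)}" using ij by (simp add: f_def)
  moreover have "f (i, 0) - f v = S_weight d {(i, 0), v}" if "v \<in> neighbours (S_edges g d) (i, 0) - {(i, j)}" for v
    using that ne unfolding neighbours_S_cycle[OF g2 ij(1)]
    by (auto simp: f_def a_def[symmetric] split: if_splits)
  ultimately show ?thesis
    unfolding edge_potential_def using ij by (intro exI[of _ f]) (auto simp: neighbours_S_leaf[OF g2])
qed

text \<open>
  On \<open>C\<^sub>g\<close> the potential of the edge from \<open>i\<close> to \<open>i + 1\<close> must take the values \<open>1, 0, -1, -2\<close> (in
  units of the cycle edge weight) at \<open>i - 1, \<dots>, i + 2\<close>. It can climb back from \<open>-2\<close> to \<open>1\<close> along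
  the remaining \<open>g - 3\<close> edges exactly when \<open>g \<ge> 6\<close>.
\<close>

lemma edge_potential_S_cycle:
  assumes g: "g \<ge> 6" and d: "d \<ge> 1" and i: "i < g"
  shows "\<exists>f. edge_potential (S_edges g d) (S_weight d) (i, 0) (Suc i mod g, 0) f"
proof -
  define a where "a = sqrt (real d - 1) + 1"
  have a: "a > 0" using d by (simp add: a_def add_nonneg_pos)
  have g2: "g \<ge> 2" using g by simp
  \<comment> \<open>\<open>t\<close> measures the position on the cycle relative to
    \<open>i\<close>, so the edge in question runs from position 0 to position 1.\<close>
  define t where "t k = (k + (g - i)) mod g" for k
  \<comment> \<open>The values are 0, -1, -2, -1, 0, 1 and then constantly 1. Position
    \<open>g - 1\<close> must have value 1, which is first reached at position 5.\<close>
  define H :: "nat \<Rightarrow> int" where "H n = (if n \<le> 2 then - int n else min (int n - 4) 1)" for n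
  \<comment> \<open>Leaves at \<open>i\<close> lie one above their cycle vertex and leaves at its
    successor one below, so both are tight; all other leaves copy the value of their cycle
    vertex.\<close>
  define f :: "nat \<times> nat \<Rightarrow> real" where "f = (\<lambda>(k, l). a * of_int (H (t k)) +
    (if l = 0 then 0 else if k = i then 1 else if k = Suc i mod g then - 1 else 0))"
  have H: "\<bar>H n - H (Suc n mod g)\<bar> \<le> 1" if "n < g" for n
    using that g by (cases "Suc n = g") (auto simp: H_def)
  have tSuc: "t (Suc k mod g) = Suc (t k) mod g" for k
    by (simp add: t_def mod_Suc_eq mod_add_left_eq)
  have tlt: "t k < g" for k using g by (simp add: t_def)
  have ti: "t i = 0" using i by (simp add: t_def)
  have t1: "t (Suc i mod g) = 1" unfolding tSuc ti using g by simp
  have t2: "t (Suc (Suc i mod g) mod g) = 2" unfolding tSuc ti using g by simp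
  have tp: "t ((i + g - 1) mod g) = g - 1"
  proof -
    have "t (Suc ((i + g - 1) mod g) mod g) = 0"
      using Suc_mod_eq_iff_pred[of i g "(i + g - 1) mod g"] i ti by simp
    then have "Suc (t ((i + g - 1) mod g)) mod g = 0" by (simp add: tSuc)
    then show ?thesis using tlt[of "(i + g - 1) mod g"] by (auto simp: mod_Suc split: if_splits)
  qed
  have aH: "a * of_int (H m) - a * of_int (H n) \<le> a" if "\<bar>H m - H n\<bar> \<le> 1" for m n
  proof -
    have "a * (of_int (H m) - of_int (H n)) \<le> a * 1"
      using a that by (intro mult_left_mono) linarith+
    then show ?thesis by (simp add: algebra_simps)
  qed
  have cyc: "a * of_int (H (t k)) - a * of_int (H (t (Suc k mod g))) \<le> a"
    "a * of_int (H (t (Suc k mod g))) - a * of_int (H (t k)) \<le> a" for k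
    using aH H[OF tlt] unfolding tSuc by (simp_all add: abs_minus_commute)
  have lip: "f u - f v \<le> S_weight d {u, v}" if "{u, v} \<in> S_edges g d" for u v
  proof -
    obtain k l k' l' where uv: "u = (k, l)" "v = (k', l')" by fastforce
    show ?thesis
      using that a g2 cyc[of k] cyc[of k'] unfolding uv
      by (auto simp: S_edge_cases f_def a_def[symmetric])
  qed
  define y where "y = Suc i mod g"
  have yi: "y < g" "y \<noteq> i" using g Suc_mod_neq[OF i g2] by (auto simp: y_def)
  have yp: "(y + g - 1) mod g = i" using Suc_mod_eq_iff_pred[of y g i] yi i y_def by simp
  have val: "H 0 = 0" "H 1 = - 1" "H 2 = - 2" "H (g - 1) = 1" using g by (auto simp: H_def)
  have "f (i, 0) - f (y, 0) = S_weight d {(i, 0), (y, 0)}"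
    by (simp add: f_def ti t1 y_def val del: One_nat_def flip: a_def)
  moreover have "f u - f (i, 0) = S_weight d {(i, 0), u}" if "u \<in> neighbours (S_edges g d) (i, 0) - {(y, 0)}" for u
    using that unfolding neighbours_S_cycle[OF g2 i]
    by (auto simp: f_def ti tp val y_def simp del: One_nat_def simp flip: a_def)
  moreover have "f (y, 0) - f v = S_weight d {(y, 0), v}" if "v \<in> neighbours (S_edges g d) (y, 0) - {(i, 0)}" for v
    using that yi unfolding neighbours_S_cycle[OF g2 yi(1)] yp
    by (auto simp: f_def t1 t2 val y_def simp del: One_nat_def simp flip: a_def)
  ultimately show ?thesis
    unfolding edge_potential_def y_def[symmetric] using lip by (intro exI[of _ f]) auto
qed

lemma discrete_Einstein_metric_S:
  assumes g: "g \<ge> 6" and d: "d \<ge> 3"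
  shows "discrete_Einstein_metric (S_verts g d) (S_edges g d) (S_weight d) (- F_fun (real d))"
proof (rule discrete_Einstein_metricI)
  show "connected_graph (S_verts g d) (S_edges g d)" using g by (intro connected_graph_S) simp
  show "S_weight d e > 0" for e using d by (intro S_weight_pos) simp
  show "(\<Sum>e'\<in>S_edges g d. ricci_matrix (S_edges g d) e e' * S_weight d e') =
      F_fun (real d) * S_weight d e" if "e \<in> S_edges g d" for e
    using that g d by (intro ricci_S_weight) auto
  fix x y :: "nat \<times> nat" assume e: "{x, y} \<in> S_edges g d"
  obtain i j k l where xy: "x = (i, j)" "y = (k, l)" by fastforce
  \<comment> \<open>Naming the existence statement lets \<open>sym\<close> act as an introduction
    rule, so each kind of edge is treated in one orientation only.\<close>
  define P where "P u v \<longleftrightarrow> (\<exists>f. edge_potential (S_edges g d) (S_weight d) u v f)" for u v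
  have sym: "P u v" if "P v u" for u v 
  proof -
    from that obtain f where "edge_potential (S_edges g d) (S_weight d) v u f" unfolding P_def by blast
    from edge_potential_uminus[OF this] show ?thesis unfolding P_def by (rule exI[of _ "\<lambda>z. - f z"])
  qed
  have leaf: "P (i, j) (i, 0)" if "i < g" "j \<in> {1..d - 2}" for i j
    unfolding P_def using that g d by (intro edge_potential_S_leaf) auto
  have cycle: "P (i, 0) (Suc i mod g, 0)" if "i < g" for i
    unfolding P_def using that g d by (intro edge_potential_S_cycle) auto
  have "P x y" using e g unfolding xy by (auto simp: S_edge_cases intro: leaf cycle sym[OF leaf] sym[OF cycle])
  then show "\<exists>f. edge_potential (S_edges g d) (S_weight d) x y f" by (simp add: P_def)
qed

theorem corollary5p3:
  "filterlim F_fun (at_right 0) at_top \<and>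
   (\<forall>d::real. d \<ge> 1 \<longrightarrow> F_fun d \<le> F_fun (4 + 2 * sqrt 2)) \<and>
   (\<forall>n::int. n \<ge> 1 \<longrightarrow> F_fun (of_int n) \<le> F_fun 7) \<and>
   F_fun 7 = 2 * (sqrt 6 - 1) / 7 \<and>
   (\<forall>g::nat. g \<ge> 6 \<longrightarrow>
      (\<forall>d::nat. d \<ge> 3 \<longrightarrow>
         unicyclic (S_verts g d) (S_edges g d) \<and>
         (\<exists>w. discrete_Einstein_metric (S_verts g d) (S_edges g d) w (- S_lambda_max g d)) \<and>
         - S_lambda_max g d < 0) \<and>
      (\<lambda>d. - S_lambda_max g d) \<longlonglongrightarrow> 0) \<and>
   (\<forall>g::nat. g \<ge> 6 \<longrightarrow> (\<forall>d::nat. d \<ge> 3 \<longrightarrow> S_lambda_max g d \<le> 2 * (sqrt 6 - 1) / 7))"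
proof (intro conjI allI impI)
  show "filterlim F_fun (at_right 0) at_top" by (rule filterlim_F_fun)
  show "F_fun 7 = 2 * (sqrt 6 - 1) / 7" by (rule F_fun_7)
  show "F_fun d \<le> F_fun (4 + 2 * sqrt 2)" if "d \<ge> 1" for d using that by (rule F_fun_le_max)
  show "F_fun (of_int n) \<le> F_fun 7" if "n \<ge> 1" for n using that by (rule F_fun_le_7)
next
  fix g d :: nat assume "g \<ge> 6" "d \<ge> 3"
  then have lam: "S_lambda_max g d = F_fun (real d)" by (intro S_lambda_max_eq) auto
  show "unicyclic (S_verts g d) (S_edges g d)" using \<open>g \<ge> 6\<close> by (intro unicyclic_S) simp
  show "\<exists>w. discrete_Einstein_metric (S_verts g d) (S_edges g d) w (- S_lambda_max g d)"
    unfolding lam using discrete_Einstein_metric_S \<open>g \<ge> 6\<close> \<open>d \<ge> 3\<close> by blast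
  show "- S_lambda_max g d < 0" unfolding lam using F_fun_pos[of "real d"] \<open>d \<ge> 3\<close> by simp
  show "S_lambda_max g d \<le> 2 * (sqrt 6 - 1) / 7"
    unfolding lam using F_fun_le_7[of "int d"] \<open>d \<ge> 3\<close> F_fun_7 by simp
next
  fix g :: nat assume "g \<ge> 6"
  \<comment> \<open>The closed form is available only from \<open>d = 3\<close> on, which is enough
    for the limit.\<close>
  then have "\<forall>\<^sub>F d in sequentially. - F_fun (real d) = - S_lambda_max g d"
    using S_lambda_max_eq[of g] by (intro eventually_sequentiallyI[of 3]) auto
  moreover have "(\<lambda>d. - F_fun (real d)) \<longlonglongrightarrow> 0"
  proof -
    have "(\<lambda>d. F_fun (real d)) \<longlonglongrightarrow> 0"
      using filterlim_F_fun filterlim_real_sequentially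
      by (auto simp: filterlim_at intro: filterlim_compose)
    then show ?thesis using tendsto_minus by fastforce
  qed
  ultimately show "(\<lambda>d. - S_lambda_max g d) \<longlonglongrightarrow> 0" by (rule Lim_transform_eventually[rotated])
qed

end
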